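(* Let $Y_{n+1}$ be a real-valued future outcome with finite conditional second moment given the data ${\mathcal{D}}_n$, and let $V=(V_1,\ldots,V_K)$, $K\geq 1$, be a discrete random vector, where each $V_k$ takes values in a finite set of levels $\{v_{k1},\ldots,v_{km_k}\}$. The components $V_k$ are not assumed independent. Let $\mathrm{Var}(Y_{n+1}\mid {\mathcal{D}}_n)({\mathcal{V}}^{K})$ denote the posterior predictive variance of $Y_{n+1}$ under the joint model defined by the $K$ factors $V_1,\ldots,V_K$. Then the following two expressions hold. (i) For $K=1$, $$\mathrm{Var}(Y_{n+1}\mid {\mathcal{D}}_n)({\mathcal{V}}^{1}) = E_{V_1}\mathrm{Var}(Y_{n+1}\mid {\mathcal{D}}_n,V_1)+\mathrm{Var}_{V_1}E(Y_{n+1}\mid {\mathcal{D}}_n,V_1),$$ and for $K\geq 2$, $$\mathrm{Var}(Y_{n+1}\mid {\mathcal{D}}_n)({\mathcal{V}}^{K}) = E_{(V_1,\ldots,V_K)}\mathrm{Var}(Y_{n+1}\mid {\mathcal{D}}_n,V_1,\ldots,V_K) + \sum_{k=2}^{K}E_{(V_1,\ldots,V_{k-1})}\mathrm{Var}_{V_k}E(Y_{n+1}\mid {\mathcal{D}}_n,V_1,\ldots,V_k) + \mathrm{Var}_{V_1}E(Y_{n+1}\mid {\mathcal{D}}_n,V_1).$$ (ii) For any $K\geq 1$, $$\mathrm{Var}(Y_{n+1}\mid {\mathcal{D}}_n)({\mathcal{V}}^{K}) = E_{(V_1,\ldots,V_K)}\mathrm{Var}(Y_{n+1}\mid {\mathcal{D}}_n,V_1,\ldots,V_K)+\mathrm{Var}_{(V_1,\ldots,V_K)}E(Y_{n+1}\mid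 {\mathcal{D}}_n,V_1,\ldots,V_K).$$
   Context: ${\mathcal{D}}_n$ denotes the observed data and $Y_{n+1}$ the next (future) response. The vector $V=(V_1,\ldots,V_K)$ represents $K$ modeling choices ("factors") needed to specify a predictor; $V_k$ takes finitely many values (levels) $v_{k1},\ldots,v_{km_k}$, and $V$ has a prior probability mass function $W(v)=W(V_1=v_1,\ldots,V_K=v_K)$. The model list is ${\mathcal{V}}^{K}=\{v_{11},\ldots,v_{1m_1}\}\cup\cdots\cup\{v_{K1},\ldots,v_{Km_K}\}$, and the argument $({\mathcal{V}}^{K})$ records that the posterior predictive distribution of $Y_{n+1}$ given ${\mathcal{D}}_n$ is the one obtained from the joint model including the factors $V_1,\ldots,V_K$, i.e. the mixture over $v$ of the conditional laws of $Y_{n+1}$ given $({\mathcal{D}}_n, V=v)$ with the posterior probabilities of $V=v$ given ${\mathcal{D}}_n$ as weights. All expectations and variances are conditional on ${\mathcal{D}}_n$: $E_{(V_1,\ldots,V_k)}$ is the expectation over the conditional (posterior) distribution of $(V_1,\ldots,V_k)$ given ${\mathcal{D}}_n$; $\mathrm{Var}_{V_1}$ and $\mathrm{Var}_{(V_1,\ldots,V_K)}$ are variances over the conditional distributions of $V_1$ and of $(V_1,\ldots,V_K)$ given ${\mathcal{D}}_n$; for $k\geq 2$, inside $E_{(V_1,\ldots,V_{k-1})}$, $\mathrm{Var}_{V_k}$ is the variance over the conditional distribution of $V_k$ given ${\mathcal{D}}_n,V_1,\ldots,V_{k-1}$. *)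

theory Defs
  imports "HOL-Probability.Probability"
begin

text \<open>
  A value of \<open>V = (V\<^sub>1, \<dots>, V\<^sub>K)\<close> is a function on \<open>{1..K}\<close>, extended by \<open>undefined\<close>
  (an element of \<open>PiE {1..K} lev\<close>, where \<open>lev k\<close> is the finite set of levels of factor \<open>k\<close>).
  The joint law of \<open>(V, D, Y)\<close> is \<open>W(v) S\<^sub>v(dd) Q\<^sub>d\<^sub>,\<^sub>v(dy)\<close>: \<open>W\<close> is the prior, \<open>S v\<close> is the law
  of the data given \<open>V = v\<close>, and \<open>Q d v\<close> is the law of the next response given data \<open>d\<close> and
  \<open>V = v\<close>. The values of \<open>S v\<close> and \<open>Q d v\<close> at \<open>v\<close> outside the product of the level sets play
  no role; they are only required to be probability measures because the functions are total.
\<close>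

definition factor_model ::
  "nat \<Rightarrow> (nat \<Rightarrow> 'v set) \<Rightarrow> (nat \<Rightarrow> 'v) pmf \<Rightarrow> 'd measure \<Rightarrow> ((nat \<Rightarrow> 'v) \<Rightarrow> 'd measure)
    \<Rightarrow> ('d \<Rightarrow> (nat \<Rightarrow> 'v) \<Rightarrow> real measure) \<Rightarrow> bool"
where
  "factor_model K lev W N S Q \<longleftrightarrow>
     (\<forall>k\<in>{1..K}. finite (lev k)) \<and>
     set_pmf W \<subseteq> PiE {1..K} lev \<and>
     (\<forall>v. S v \<in> space (prob_algebra N)) \<and>
     (\<forall>v. (\<lambda>d. Q d v) \<in> N \<rightarrow>\<^sub>M prob_algebra borel)"

text \<open>
  \<open>post\<close> is a version of the conditional distribution of \<open>V\<close> given the data: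
  \<open>P(V = v, D \<in> A) = \<integral>\<^sub>A post(v | d) P\<^sub>D(dd)\<close>, where \<open>P\<^sub>D\<close> is the marginal law of the data.
\<close>

definition posterior_version ::
  "nat \<Rightarrow> (nat \<Rightarrow> 'v set) \<Rightarrow> (nat \<Rightarrow> 'v) pmf \<Rightarrow> 'd measure \<Rightarrow> ((nat \<Rightarrow> 'v) \<Rightarrow> 'd measure)
    \<Rightarrow> ('d \<Rightarrow> (nat \<Rightarrow> 'v) pmf) \<Rightarrow> bool"
where
  "posterior_version K lev W N S post \<longleftrightarrow>
     (\<forall>d\<in>space N. set_pmf (post d) \<subseteq> PiE {1..K} lev) \<and>
     (\<forall>v. (\<lambda>d. pmf (post d) v) \<in> borel_measurable N) \<and>
     (\<forall>v. \<forall>A\<in>sets N.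
        pmf W v * measure (S v) A
          = (LINT d:A|(measure_pmf W \<bind> S). pmf (post d) v))"

text \<open>
  In the remaining definitions the data \<open>d\<close> are fixed, \<open>p\<close> stands for \<open>post d\<close> and \<open>q\<close> for
  \<open>Q d\<close>. A value of \<open>(V\<^sub>1, \<dots>, V\<^sub>k)\<close> is a function \<open>u\<close> that is \<open>undefined\<close> outside \<open>{1..k}\<close>.
\<close>

definition predictive :: "(nat \<Rightarrow> 'v) pmf \<Rightarrow> ((nat \<Rightarrow> 'v) \<Rightarrow> real measure) \<Rightarrow> real measure" where
  "predictive p q = measure_pmf p \<bind> q"

definition prefix_dist :: "(nat \<Rightarrow> 'v) pmf \<Rightarrow> nat \<Rightarrow> (nat \<Rightarrow> 'v) pmf" where
  "prefix_dist p k = map_pmf (\<lambda>v. restrict v {1..k}) p"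

definition given_prefix :: "(nat \<Rightarrow> 'v) pmf \<Rightarrow> nat \<Rightarrow> (nat \<Rightarrow> 'v) \<Rightarrow> (nat \<Rightarrow> 'v) pmf" where
  "given_prefix p k u = cond_pmf p {v. restrict v {1..k} = u}"

text \<open>The conditional distribution of \<open>V\<^sub>k\<close> given \<open>(V\<^sub>1, \<dots>, V\<^sub>k\<^sub>-\<^sub>1) = u\<close>.\<close>

definition next_factor_dist :: "(nat \<Rightarrow> 'v) pmf \<Rightarrow> nat \<Rightarrow> (nat \<Rightarrow> 'v) \<Rightarrow> 'v pmf" where
  "next_factor_dist p k u = map_pmf (\<lambda>v. v k) (given_prefix p (k - 1) u)"

text \<open>\<open>E(Y | d, (V\<^sub>1, \<dots>, V\<^sub>k) = u)\<close> and \<open>Var(Y | d, (V\<^sub>1, \<dots>, V\<^sub>k) = u)\<close>.\<close>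

definition cond_mean ::
  "(nat \<Rightarrow> 'v) pmf \<Rightarrow> ((nat \<Rightarrow> 'v) \<Rightarrow> real measure) \<Rightarrow> nat \<Rightarrow> (nat \<Rightarrow> 'v) \<Rightarrow> real" where
  "cond_mean p q k u = prob_space.expectation (predictive (given_prefix p k u) q) (\<lambda>y. y)"

definition cond_var ::
  "(nat \<Rightarrow> 'v) pmf \<Rightarrow> ((nat \<Rightarrow> 'v) \<Rightarrow> real measure) \<Rightarrow> nat \<Rightarrow> (nat \<Rightarrow> 'v) \<Rightarrow> real" where
  "cond_var p q k u = prob_space.variance (predictive (given_prefix p k u) q) (\<lambda>y. y)"

end

theory Submission imports Defs begin

text \<open>
  Given \<open>(V\<^sub>1, \<dots>, V\<^sub>k)\<close>, the conditional mean of \<open>Y\<close> averages the means \<open>m v\<close> of the laws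
  \<open>q v\<close>. Writing \<open>A\<^sub>k\<close> for the second moment of the \<open>k\<close>-th conditional mean, the tower property gives
  \<open>E Var(Y | V\<^sub>1, \<dots>, V\<^sub>k) = E Y\<^sup>2 - A\<^sub>k\<close> and \<open>Var E(Y | V\<^sub>1, \<dots>, V\<^sub>k) = A\<^sub>k - (E Y)\<^sup>2\<close>, while the
  \<open>k\<close>-th summand is \<open>A\<^sub>k - A\<^sub>k\<^sub>-\<^sub>1\<close>, so the sum over \<open>k\<close> telescopes.
\<close>

section \<open>Finitely supported distributions\<close>

lemma expectation_pmf_cong:
  fixes f g :: "'a \<Rightarrow> real"
  assumes "\<And>x. x \<in> set_pmf p \<Longrightarrow> f x = g x"
  shows "measure_pmf.expectation p f = measure_pmf.expectation p g"
  using assms by (intro integral_cong_AE) (auto simp: AE_measure_pmf_iff)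

lemma variance_finite_pmf:
  fixes f :: "'a \<Rightarrow> real"
  assumes "finite (set_pmf p)"
  shows "measure_pmf.variance p f
    = measure_pmf.expectation p (\<lambda>x. (f x)\<^sup>2) - (measure_pmf.expectation p f)\<^sup>2"
  using assms by (intro measure_pmf.variance_eq integrable_measure_pmf_finite)

lemma expectation_bind_finite_pmf:
  fixes h :: "'b \<Rightarrow> real"
  assumes "finite (set_pmf p)" "\<And>x. x \<in> set_pmf p \<Longrightarrow> finite (set_pmf (f x))"
  shows "measure_pmf.expectation (bind_pmf p f) h
    = measure_pmf.expectation p (\<lambda>x. measure_pmf.expectation (f x) h)"
  by (subst pmf_expectation_bind[of "set_pmf p"]; (subst integral_measure_pmf[of "set_pmf p"])?)
     (use assms in auto)

text \<open>Law of total probability: drawing the value of \<open>r\<close> first and then a point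
  of its fibre reproduces \<open>p\<close>, since a fibre has the same mass under \<open>p\<close>
  as its value has under the image law. The tower property rests on this.\<close>

lemma bind_map_cond_pmf:
  "bind_pmf (map_pmf r p) (\<lambda>u. cond_pmf p {v. r v = u}) = p"
proof (rule bind_cond_pmf_cancel)
  fix x y assume "r y = x"
  then show "measure_pmf.prob p {v. r v = x} = measure_pmf.prob (map_pmf r p) {u. r y = u}"
    by (auto simp: vimage_def intro!: arg_cong[where f = "measure_pmf.prob p"])
qed auto

text \<open>Conditioning on \<open>A\<close> divides masses by P(A), and conditioning on
  \<open>B\<close> afterwards divides by P(B)/P(A), so P(A) cancels.\<close>

lemma cond_cond_pmf:
  assumes "B \<subseteq> A" "set_pmf p \<inter> B \<noteq> {}"
  shows "cond_pmf (cond_pmf p A) B = cond_pmf p B"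
proof (rule pmf_eqI)
  fix x
  have A: "set_pmf p \<inter> A \<noteq> {}" using assms by auto
  have AB: "set_pmf (cond_pmf p A) \<inter> B \<noteq> {}"
    unfolding set_cond_pmf[OF A] using assms by auto
  have pos: "measure_pmf.prob p A > 0" "measure_pmf.prob p B > 0"
    using A assms(2) by (auto intro: measure_pmf_posI)
  have "measure_pmf.prob (cond_pmf p A) B = measure_pmf.prob p (A \<inter> B) / measure_pmf.prob p A"
    by (subst cond_pmf.rep_eq[OF A], subst measure_uniform_measure)
       (use pos in \<open>auto simp: measure_pmf.emeasure_eq_measure\<close>)
  moreover have "A \<inter> B = B" using assms(1) by auto
  ultimately show "pmf (cond_pmf (cond_pmf p A) B) x = pmf (cond_pmf p B) x"
    using assms(1) pos by (auto simp: pmf_cond[OF AB] pmf_cond[OF A] pmf_cond[OF assms(2)])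
qed

section \<open>Prefixes of the factor vector\<close>

text \<open>\<open>cond_pmf\<close> is specified only for events that meet the support. A prefix of
  positive probability guarantees this, which is why later identities are stated for such
  prefixes.\<close>

lemma set_given_prefix:
  assumes "u \<in> set_pmf (prefix_dist p k)"
  shows "set_pmf (given_prefix p k u) = set_pmf p \<inter> {v. restrict v {1..k} = u}"
  unfolding given_prefix_def
  by (rule set_cond_pmf) (use assms in \<open>auto simp: prefix_dist_def\<close>)

lemma finite_set_prefix_dist: "finite (set_pmf p) \<Longrightarrow> finite (set_pmf (prefix_dist p k))"
  by (simp add: prefix_dist_def)

lemma expectation_given_prefix_tower:
  fixes h :: "(nat \<Rightarrow> 'v) \<Rightarrow> real"
  assumes "finite (set_pmf p)"
  shows "measure_pmf.expectation (prefix_dist p k)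
      (\<lambda>u. measure_pmf.expectation (given_prefix p k u) h) = measure_pmf.expectation p h"
proof -
  have "bind_pmf (prefix_dist p k) (given_prefix p k) = p"
    using bind_map_cond_pmf[of "\<lambda>v. restrict v {1..k}" p]
    by (simp add: prefix_dist_def given_prefix_def[abs_def])
  then show ?thesis
    using expectation_bind_finite_pmf[of "prefix_dist p k" "given_prefix p k" h]
    by (simp add: assms finite_set_prefix_dist set_given_prefix)
qed

text \<open>A longer prefix determines every shorter one, so the event fixing \<open>w\<close> lies
  inside the event fixing \<open>u\<close> and \<open>cond_cond_pmf\<close> applies.\<close>

lemma given_prefix_given_prefix:
  assumes "j \<le> k" "u \<in> set_pmf (prefix_dist p j)" "w \<in> set_pmf (prefix_dist (given_prefix p j u) k)"
  shows "given_prefix (given_prefix p j u) k w = given_prefix p k w"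
proof -
  obtain v where v: "v \<in> set_pmf p" "restrict v {1..j} = u" "restrict v {1..k} = w"
    using assms(3) by (auto simp: prefix_dist_def set_given_prefix[OF assms(2)])
  have "restrict v' {1..j} = u" if "restrict v' {1..k} = w" for v'
  proof -
    have "restrict f {1..j} = restrict (restrict f {1..k}) {1..j}" for f :: "nat \<Rightarrow> 'a"
      using assms(1) by (simp add: restrict_restrict Int_absorb1)
    then show ?thesis using that v by metis
  qed
  then show ?thesis
    unfolding given_prefix_def by (intro cond_cond_pmf) (use v in auto)
qed

lemma prefix_dist_given_prefix:
  assumes "k \<ge> 1" "u \<in> set_pmf (prefix_dist p (k - 1))"
  shows "prefix_dist (given_prefix p (k - 1) u) k
    = map_pmf (\<lambda>x. u(k := x)) (next_factor_dist p k u)"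
proof -
  \<comment> \<open>\<open>u\<close> is \<open>undefined\<close> outside \<open>{1..k - 1}\<close>,
    so updating it at \<open>k\<close> yields exactly the restriction to \<open>{1..k}\<close>; for
    \<open>k = 0\<close> this would fail.\<close>
  have "restrict v {1..k} = u(k := v k)" if "restrict v {1..k - 1} = u" for v
    using assms(1) unfolding that[symmetric] by (auto simp: fun_eq_iff restrict_def)
  then show ?thesis
    unfolding prefix_dist_def next_factor_dist_def map_pmf_comp
    by (intro map_pmf_cong refl) (simp add: set_given_prefix[OF assms(2)] del: One_nat_def)
qed

text \<open>A function of the prefix is a function of the whole vector, so this is the tower
  property for \<open>g\<close> composed with restriction.\<close>

lemma expectation_prefix_dist_given_prefix:
  fixes g :: "(nat \<Rightarrow> 'v) \<Rightarrow> real"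
  assumes "finite (set_pmf p)"
  shows "measure_pmf.expectation (prefix_dist p j)
      (\<lambda>u. measure_pmf.expectation (prefix_dist (given_prefix p j u) k) g)
    = measure_pmf.expectation (prefix_dist p k) g"
  using expectation_given_prefix_tower[OF assms, where h = "\<lambda>v. g (restrict v {1..k})"]
  by (simp add: prefix_dist_def[of _ k])

text \<open>Given \<open>u\<close>, the mean of \<open>M k\<close> over the next factor is
  \<open>M (k - 1) u\<close>, so the inner variance is a second moment minus
  \<open>(M (k - 1) u)\<^sup>2\<close>; averaging over \<open>u\<close> gives the increment. Later
  \<open>h\<close> is the mean of \<open>q v\<close>.\<close>

lemma expectation_next_factor_variance:
  fixes h :: "(nat \<Rightarrow> 'v) \<Rightarrow> real"
  assumes fin: "finite (set_pmf p)" and k: "k \<ge> 1"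
  defines "M \<equiv> \<lambda>j u. measure_pmf.expectation (given_prefix p j u) h"
  shows "measure_pmf.expectation (prefix_dist p (k - 1))
      (\<lambda>u. measure_pmf.variance (next_factor_dist p k u) (\<lambda>x. M k (u(k := x))))
    = measure_pmf.expectation (prefix_dist p k) (\<lambda>u. (M k u)\<^sup>2)
      - measure_pmf.expectation (prefix_dist p (k - 1)) (\<lambda>u. (M (k - 1) u)\<^sup>2)"
proof -
  have step: "measure_pmf.variance (next_factor_dist p k u) (\<lambda>x. M k (u(k := x)))
      = measure_pmf.expectation (prefix_dist (given_prefix p (k - 1) u) k) (\<lambda>w. (M k w)\<^sup>2)
        - (M (k - 1) u)\<^sup>2"
    if u: "u \<in> set_pmf (prefix_dist p (k - 1))" for u
  proof -
    let ?p = "given_prefix p (k - 1) u"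
    have finp: "finite (set_pmf ?p)" using fin by (simp add: set_given_prefix[OF u] del: One_nat_def)
    \<comment> \<open>The tower property is used inside the conditional law given \<open>u\<close>;
      the nested conditioning then collapses to conditioning on \<open>w\<close> alone.\<close>
    have "M (k - 1) u = measure_pmf.expectation (prefix_dist ?p k)
        (\<lambda>w. measure_pmf.expectation (given_prefix ?p k w) h)"
      unfolding M_def by (rule expectation_given_prefix_tower[OF finp, symmetric])
    also have "\<dots> = measure_pmf.expectation (prefix_dist ?p k) (M k)"
      unfolding M_def by (intro expectation_pmf_cong) (simp add: given_prefix_given_prefix[OF _ u] del: One_nat_def)
    finally have mean: "M (k - 1) u = measure_pmf.expectation (prefix_dist ?p k) (M k)" .
    have "finite (set_pmf (next_factor_dist p k u))"
      using finp by (simp add: next_factor_dist_def)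
    from variance_finite_pmf[OF this, of "\<lambda>x. M k (u(k := x))"] show ?thesis
      unfolding mean by (simp add: prefix_dist_given_prefix[OF k u] del: One_nat_def)
  qed
  have "measure_pmf.expectation (prefix_dist p (k - 1))
      (\<lambda>u. measure_pmf.variance (next_factor_dist p k u) (\<lambda>x. M k (u(k := x))))
    = measure_pmf.expectation (prefix_dist p (k - 1))
      (\<lambda>u. measure_pmf.expectation (prefix_dist (given_prefix p (k - 1) u) k) (\<lambda>w. (M k w)\<^sup>2)
        - (M (k - 1) u)\<^sup>2)"
    by (rule expectation_pmf_cong) (rule step)
  then show ?thesis
    by (simp add: Bochner_Integration.integral_diff integrable_measure_pmf_finite
        finite_set_prefix_dist fin expectation_prefix_dist_given_prefix)
qed

section \<open>The predictive distribution\<close>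

lemma prob_algebra_sets: "M \<in> space (prob_algebra B) \<Longrightarrow> sets M = sets B"
  and prob_algebra_prob_space: "M \<in> space (prob_algebra B) \<Longrightarrow> prob_space M"
  by (simp_all add: space_prob_algebra)

lemma prob_kernel_measurable:
  fixes q :: "'a \<Rightarrow> 'b measure"
  assumes "\<And>v. q v \<in> space (prob_algebra B)"
  shows "q \<in> measure_pmf p \<rightarrow>\<^sub>M prob_algebra B"
  unfolding measurable_pmf_measure1 by (intro Pi_I assms)

lemma nn_integral_predictive:
  assumes "finite (set_pmf p)" "\<And>v. q v \<in> space (prob_algebra borel)"
    and "f \<in> borel_measurable borel"
  shows "(\<integral>\<^sup>+y. f y \<partial>predictive p q) = (\<Sum>v\<in>set_pmf p. (\<integral>\<^sup>+y. f y \<partial>q v) * pmf p v)"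
  unfolding predictive_def
  by (subst nn_integral_bind[OF assms(3) measurable_prob_algebraD[OF prob_kernel_measurable[OF assms(2)]]])
     (simp add: nn_integral_measure_pmf_finite[OF assms(1)])

lemma sets_predictive:
  assumes "\<And>v. q v \<in> space (prob_algebra borel)"
  shows "sets (predictive p q) = sets borel"
  unfolding predictive_def
  by (rule sets_bind) (simp_all add: prob_algebra_sets[OF assms])

lemma prob_space_predictive:
  assumes "\<And>v. q v \<in> space (prob_algebra borel)"
  shows "prob_space (predictive p q)"
  unfolding predictive_def
  by (rule measure_pmf.prob_space_bind[OF _ measurable_prob_algebraD[OF prob_kernel_measurable[OF assms]]])
     (simp add: prob_algebra_prob_space[OF assms])

text \<open>The integral of the norm is a finite sum with positive weights, hence finite iff every
  term is. This passes the second moment hypothesis on the mixture to each component.\<close>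

lemma integrable_predictive_iff:
  fixes f :: "real \<Rightarrow> real"
  assumes "finite (set_pmf p)" and q: "\<And>v. q v \<in> space (prob_algebra borel)"
    and f: "f \<in> borel_measurable borel"
  shows "integrable (predictive p q) f \<longleftrightarrow> (\<forall>v\<in>set_pmf p. integrable (q v) f)"
proof -
  have "f \<in> borel_measurable (predictive p q)" "\<And>v. f \<in> borel_measurable (q v)"
    using f by (simp_all only: measurable_cong_sets[OF sets_predictive[OF q] refl] measurable_cong_sets[OF prob_algebra_sets[OF q] refl])
  then show ?thesis
    using f assms(1)
    by (auto simp: integrable_iff_bounded nn_integral_predictive[OF assms(1) q] ennreal_mult_less_top
        set_pmf_iff)
qed

lemma integral_predictive:
  fixes f :: "real \<Rightarrow> real"
  assumes fin: "finite (set_pmf p)" and q: "\<And>v. q v \<in> space (prob_algebra borel)"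
    and f: "f \<in> borel_measurable borel" and int: "\<And>v. v \<in> set_pmf p \<Longrightarrow> integrable (q v) f"
  shows "(\<integral>y. f y \<partial>predictive p q) = measure_pmf.expectation p (\<lambda>v. \<integral>y. f y \<partial>q v)"
proof -
  \<comment> \<open>\<open>ennreal\<close> sends negative reals to 0, so this is the integral of the
    positive part of \<open>g\<close>. Taking \<open>g\<close> to be \<open>f\<close> and then its
    negative gives both halves of the Lebesgue integral.\<close>
  have part: "enn2real (\<integral>\<^sup>+y. ennreal (g y) \<partial>predictive p q)
      = (\<Sum>v\<in>set_pmf p. enn2real (\<integral>\<^sup>+y. ennreal (g y) \<partial>q v) * pmf p v)"
    if g: "g \<in> borel_measurable borel" "\<And>v. v \<in> set_pmf p \<Longrightarrow> integrable (q v) g" for g :: "real \<Rightarrow> real"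
  proof -
    \<comment> \<open>\<open>enn2real\<close> maps infinity to 0 and is additive only on finite
      values, so each term must first be bounded.\<close>
    have "(\<integral>\<^sup>+y. ennreal (g y) \<partial>q v) < \<top>" if "v \<in> set_pmf p" for v
    proof -
      have "(\<integral>\<^sup>+y. ennreal (g y) \<partial>q v) \<le> (\<integral>\<^sup>+y. ennreal (norm (g y)) \<partial>q v)"
        by (intro nn_integral_mono ennreal_leI) auto
      also have "\<dots> < \<top>" using g(2)[OF that] by (simp add: integrable_iff_bounded)
      finally show ?thesis .
    qed
    then have "enn2real (\<Sum>v\<in>set_pmf p. (\<integral>\<^sup>+y. ennreal (g y) \<partial>q v) * pmf p v)
        = (\<Sum>v\<in>set_pmf p. enn2real ((\<integral>\<^sup>+y. ennreal (g y) \<partial>q v) * pmf p v))"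
      by (subst enn2real_sum) (simp_all add: ennreal_mult_less_top)
    then show ?thesis
      using g(1) by (simp add: nn_integral_predictive[OF fin q] enn2real_mult)
  qed
  have "integrable (predictive p q) f"
    using int by (simp add: integrable_predictive_iff[OF fin q f])
  then have "(\<integral>y. f y \<partial>predictive p q)
      = (\<Sum>v\<in>set_pmf p. enn2real (\<integral>\<^sup>+y. ennreal (f y) \<partial>q v) * pmf p v)
        - (\<Sum>v\<in>set_pmf p. enn2real (\<integral>\<^sup>+y. ennreal (- f y) \<partial>q v) * pmf p v)"
    using f int by (subst real_lebesgue_integral_def) (simp_all only: part borel_measurable_uminus integrable_minus)
  also have "\<dots> = (\<Sum>v\<in>set_pmf p. (\<integral>y. f y \<partial>q v) * pmf p v)"
    unfolding sum_subtractf[symmetric]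
    by (intro sum.cong refl) (simp only: real_lebesgue_integral_def[OF int] left_diff_distrib)
  also have "\<dots> = measure_pmf.expectation p (\<lambda>v. \<integral>y. f y \<partial>q v)"
    by (rule integral_measure_pmf_real[symmetric]) (use fin in auto)
  finally show ?thesis .
qed

lemma variance_predictive:
  assumes fin: "finite (set_pmf p)" and q: "\<And>v. q v \<in> space (prob_algebra borel)"
    and sq: "\<And>v. v \<in> set_pmf p \<Longrightarrow> integrable (q v) (\<lambda>y. y\<^sup>2)"
  shows "prob_space.expectation (predictive p q) (\<lambda>y. y)
      = measure_pmf.expectation p (\<lambda>v. \<integral>y. y \<partial>q v)" (is ?mean)
    and "prob_space.variance (predictive p q) (\<lambda>y. y)
      = measure_pmf.expectation p (\<lambda>v. \<integral>y. y\<^sup>2 \<partial>q v)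
        - (measure_pmf.expectation p (\<lambda>v. \<integral>y. y \<partial>q v))\<^sup>2" (is ?var)
proof -
  have int: "integrable (q v) (\<lambda>y. y)" if "v \<in> set_pmf p" for v
  proof -
    interpret prob_space "q v" by (rule prob_algebra_prob_space[OF q])
    have "(\<lambda>y. y) \<in> borel_measurable (q v)"
      by (rule measurable_ident_sets) (rule prob_algebra_sets[OF q])
    then show ?thesis by (rule square_integrable_imp_integrable) (rule sq[OF that])
  qed
  interpret P: prob_space "predictive p q" by (rule prob_space_predictive[OF q])
  show ?mean by (rule integral_predictive[OF fin q]) (simp_all add: int)
  have "integrable (predictive p q) (\<lambda>y. y)" "integrable (predictive p q) (\<lambda>y. y\<^sup>2)"
    by (simp_all add: integrable_predictive_iff[OF fin q] int sq)
  from P.variance_eq[OF this] show ?var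
    using integral_predictive[OF fin q _ sq] \<open>?mean\<close> by simp
qed

section \<open>The variance decompositions\<close>

text \<open>The data are fixed here: \<open>p\<close> and \<open>q\<close> stand for
  \<open>post d\<close> and \<open>Q d\<close>. Both formulas are proved together because they share
  the moments \<open>M\<close> and \<open>A\<close>.\<close>

lemma variance_decomposition:
  fixes p :: "(nat \<Rightarrow> 'v) pmf" and q :: "(nat \<Rightarrow> 'v) \<Rightarrow> real measure"
  assumes fin: "finite (set_pmf p)" and q: "\<And>v. q v \<in> space (prob_algebra borel)"
    and sq: "integrable (predictive p q) (\<lambda>y. y\<^sup>2)"
  shows two_term_variance_decomposition:
      "prob_space.variance (predictive p q) (\<lambda>y. y)
        = measure_pmf.expectation (prefix_dist p K) (cond_var p q K)
          + measure_pmf.variance (prefix_dist p K) (cond_mean p q K)"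
    and sequential_variance_decomposition:
      "K \<ge> 1 \<Longrightarrow> prob_space.variance (predictive p q) (\<lambda>y. y)
        = measure_pmf.expectation (prefix_dist p K) (cond_var p q K)
          + (\<Sum>k=2..K.
               measure_pmf.expectation (prefix_dist p (k - 1))
                 (\<lambda>u. measure_pmf.variance (next_factor_dist p k u)
                        (\<lambda>x. cond_mean p q k (u(k := x)))))
          + measure_pmf.variance (prefix_dist p 1) (cond_mean p q 1)"
proof -
  define m s where "m \<equiv> \<lambda>v. \<integral>y. y \<partial>q v" and "s \<equiv> \<lambda>v. \<integral>y. y\<^sup>2 \<partial>q v"
  define M where "M \<equiv> \<lambda>k u. measure_pmf.expectation (given_prefix p k u) m"
  define A where "A \<equiv> \<lambda>k. measure_pmf.expectation (prefix_dist p k) (\<lambda>u. (M k u)\<^sup>2)"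
  have sqv: "integrable (q v) (\<lambda>y. y\<^sup>2)" if "v \<in> set_pmf p" for v
    using sq that by (simp add: integrable_predictive_iff[OF fin q])
  \<comment> \<open>Restricting to prefixes in the support suffices, since expectations over
    \<open>prefix_dist p k\<close> see no others.\<close>
  have cond: "cond_mean p q k u = M k u"
      "cond_var p q k u = measure_pmf.expectation (given_prefix p k u) s - (M k u)\<^sup>2"
    if u: "u \<in> set_pmf (prefix_dist p k)" for k u
  proof -
    have "finite (set_pmf (given_prefix p k u))"
      "\<And>v. v \<in> set_pmf (given_prefix p k u) \<Longrightarrow> integrable (q v) (\<lambda>y. y\<^sup>2)"
      using fin by (auto simp: set_given_prefix[OF u] intro: sqv)
    note variance_predictive[OF this(1) q this(2)]
    then show "cond_mean p q k u = M k u"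
      "cond_var p q k u = measure_pmf.expectation (given_prefix p k u) s - (M k u)\<^sup>2"
      by (simp_all add: cond_mean_def cond_var_def M_def m_def s_def)
  qed
  have total: "prob_space.variance (predictive p q) (\<lambda>y. y)
      = measure_pmf.expectation p s - (measure_pmf.expectation p m)\<^sup>2"
    using variance_predictive(2)[OF fin q sqv] by (simp add: m_def s_def)
  have E_var: "measure_pmf.expectation (prefix_dist p k) (cond_var p q k)
      = measure_pmf.expectation p s - A k" for k
  proof -
    have "measure_pmf.expectation (prefix_dist p k) (cond_var p q k)
        = measure_pmf.expectation (prefix_dist p k)
            (\<lambda>u. measure_pmf.expectation (given_prefix p k u) s - (M k u)\<^sup>2)"
      by (rule expectation_pmf_cong) (rule cond(2))
    then show ?thesis
      by (simp add: A_def Bochner_Integration.integral_diff integrable_measure_pmf_finite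
          finite_set_prefix_dist fin expectation_given_prefix_tower)
  qed
  have Var_E: "measure_pmf.variance (prefix_dist p k) (cond_mean p q k)
      = A k - (measure_pmf.expectation p m)\<^sup>2" for k
  proof -
    have "measure_pmf.expectation (prefix_dist p k) (cond_mean p q k)
        = measure_pmf.expectation (prefix_dist p k) (M k)"
      by (rule expectation_pmf_cong) (rule cond(1))
    also have "\<dots> = measure_pmf.expectation p m"
      unfolding M_def by (rule expectation_given_prefix_tower[OF fin])
    finally have "measure_pmf.expectation (prefix_dist p k) (cond_mean p q k)
        = measure_pmf.expectation p m" .
    moreover have "measure_pmf.expectation (prefix_dist p k) (\<lambda>u. (cond_mean p q k u)\<^sup>2) = A k"
      unfolding A_def by (rule expectation_pmf_cong) (simp add: cond(1))
    ultimately show ?thesis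
      using variance_finite_pmf[OF finite_set_prefix_dist[OF fin], of k "cond_mean p q k"] by simp
  qed
  show "prob_space.variance (predictive p q) (\<lambda>y. y)
      = measure_pmf.expectation (prefix_dist p K) (cond_var p q K)
        + measure_pmf.variance (prefix_dist p K) (cond_mean p q K)"
    unfolding total E_var Var_E by simp
  have incr: "measure_pmf.expectation (prefix_dist p (k - 1))
      (\<lambda>u. measure_pmf.variance (next_factor_dist p k u) (\<lambda>x. cond_mean p q k (u(k := x))))
      = A k - A (k - 1)" if k: "k \<ge> 1" for k
  proof -
    have M: "cond_mean p q k (u(k := x)) = M k (u(k := x))"
      if u: "u \<in> set_pmf (prefix_dist p (k - 1))" and x: "x \<in> set_pmf (next_factor_dist p k u)" for u x
    proof (rule cond(1))
      \<comment> \<open>The extended prefix has positive probability given \<open>u\<close>, and the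
        support of that conditional law lies in the support of \<open>p\<close>.\<close>
      have "u(k := x) \<in> set_pmf (prefix_dist (given_prefix p (k - 1) u) k)"
        using x by (simp add: prefix_dist_given_prefix[OF k u] del: One_nat_def)
      then show "u(k := x) \<in> set_pmf (prefix_dist p k)"
        by (auto simp: prefix_dist_def[of _ k] set_given_prefix[OF u] simp del: One_nat_def)
    qed
    have "measure_pmf.variance (next_factor_dist p k u) (\<lambda>x. cond_mean p q k (u(k := x)))
        = measure_pmf.variance (next_factor_dist p k u) (\<lambda>x. M k (u(k := x)))"
      if u: "u \<in> set_pmf (prefix_dist p (k - 1))" for u
    proof -
      \<comment> \<open>The variance contains \<open>cond_mean\<close> also in its centre, which is
        rewritten first.\<close>
      have mean: "measure_pmf.expectation (next_factor_dist p k u) (\<lambda>x. cond_mean p q k (u(k := x)))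
          = measure_pmf.expectation (next_factor_dist p k u) (\<lambda>x. M k (u(k := x)))"
        by (rule expectation_pmf_cong) (rule M[OF u])
      show ?thesis
        unfolding mean by (rule expectation_pmf_cong) (simp only: M[OF u])
    qed
    then have "measure_pmf.expectation (prefix_dist p (k - 1))
          (\<lambda>u. measure_pmf.variance (next_factor_dist p k u) (\<lambda>x. cond_mean p q k (u(k := x))))
        = measure_pmf.expectation (prefix_dist p (k - 1))
          (\<lambda>u. measure_pmf.variance (next_factor_dist p k u) (\<lambda>x. M k (u(k := x))))"
      by (rule expectation_pmf_cong)
    then show ?thesis
      unfolding A_def M_def by (simp only: expectation_next_factor_variance[OF fin k])
  qed
  show "prob_space.variance (predictive p q) (\<lambda>y. y)
      = measure_pmf.expectation (prefix_dist p K) (cond_var p q K)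
        + (\<Sum>k=2..K.
             measure_pmf.expectation (prefix_dist p (k - 1))
               (\<lambda>u. measure_pmf.variance (next_factor_dist p k u)
                      (\<lambda>x. cond_mean p q k (u(k := x)))))
        + measure_pmf.variance (prefix_dist p 1) (cond_mean p q 1)" if "K \<ge> 1"
  proof -
    \<comment> \<open>The sum starts at 2, so \<open>A 1\<close> is left over; it cancels against
      the variance over the first factor. For \<open>K = 1\<close> both sides are 0.\<close>
    have "(\<Sum>k=2..K. A k - A (k - 1)) = A K - A 1"
      using sum_telescope''[OF that, of A] by (simp add: numeral_2_eq_2)
    then show ?thesis
      unfolding total E_var Var_E using incr by simp
  qed
qed

theorem proposition3p1:
  fixes K :: nat
    and lev :: "nat \<Rightarrow> 'v set"
    and W :: "(nat \<Rightarrow> 'v) pmf"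
    and N :: "'d measure"
    and S :: "(nat \<Rightarrow> 'v) \<Rightarrow> 'd measure"
    and Q :: "'d \<Rightarrow> (nat \<Rightarrow> 'v) \<Rightarrow> real measure"
    and post :: "'d \<Rightarrow> (nat \<Rightarrow> 'v) pmf"
    and d :: 'd
  assumes "K \<ge> 1"
    and "factor_model K lev W N S Q"
    and "posterior_version K lev W N S post"
    and "d \<in> space N"
    and "integrable (predictive (post d) (Q d)) (\<lambda>y. y\<^sup>2)"
  shows
    "(K = 1 \<longrightarrow>
        prob_space.variance (predictive (post d) (Q d)) (\<lambda>y. y)
          = measure_pmf.expectation (prefix_dist (post d) 1) (cond_var (post d) (Q d) 1)
            + measure_pmf.variance (prefix_dist (post d) 1) (cond_mean (post d) (Q d) 1))
     \<and> (K \<ge> 2 \<longrightarrow>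
        prob_space.variance (predictive (post d) (Q d)) (\<lambda>y. y)
          = measure_pmf.expectation (prefix_dist (post d) K) (cond_var (post d) (Q d) K)
            + (\<Sum>k=2..K.
                 measure_pmf.expectation (prefix_dist (post d) (k - 1))
                   (\<lambda>u. measure_pmf.variance (next_factor_dist (post d) k u)
                          (\<lambda>x. cond_mean (post d) (Q d) k (u(k := x)))))
            + measure_pmf.variance (prefix_dist (post d) 1) (cond_mean (post d) (Q d) 1))
     \<and> prob_space.variance (predictive (post d) (Q d)) (\<lambda>y. y)
          = measure_pmf.expectation (prefix_dist (post d) K) (cond_var (post d) (Q d) K)
            + measure_pmf.variance (prefix_dist (post d) K) (cond_mean (post d) (Q d) K)"
proof -
  \<comment> \<open>The posterior is supported on this finite product, which reduces all
    expectations over factors to finite sums.\<close>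
  have "finite (PiE {1..K} lev)"
    using assms(2) by (intro finite_PiE) (auto simp: factor_model_def)
  then have fin: "finite (set_pmf (post d))"
    using assms(3,4) by (auto simp: posterior_version_def intro: finite_subset)
  have q: "Q d v \<in> space (prob_algebra borel)" for v
    using assms(2,4) by (auto simp: factor_model_def dest: measurable_space)
  note two = two_term_variance_decomposition[OF fin q assms(5)]
  note seq = sequential_variance_decomposition[OF fin q assms(5) assms(1)]
  show ?thesis
    \<comment> \<open>The case \<open>K = 1\<close> is the two-term formula for prefixes of length
      1.\<close>
    by (intro conjI impI; (rule seq two | use two[of 1] in simp))
qed

end
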